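(* Let $\beta>0$, let $A$ be the circulant matrix generated by $a=(a_0,\dots,a_{N-1})\in\mathbb{R}^N$, let $\phi_l=\frac{2\pi l}{N}$ and $$d=\sum_{l=1}^{N-1}a_l,\qquad\rho=\sum_{l=1}^{N-1}a_l\cos(\phi_l),\qquad\omega=\sum_{l=1}^{N-1}a_l\sin(\phi_l).$$ Consider the Stuart-Landau system $$\frac{d}{dt}z_j=\sum_{l=1}^N A_{jl}(z_l-z_j)+\frac1\tau\Bigl(1-\frac{|z_j|^2}{\beta^2}\Bigr)z_j,\qquad z_j\in\mathbb{C},\ j\in\{1,\dots,N\}.$$ (i) Suppose $d-\rho>0$ and let $\tau^*=(d-\rho)^{-1}$. Then for all $0<\tau<\tau^*$ and all $\theta\in\mathbb{S}$, the rotational twisted state $z_j(t)=Re^{i(\omega t+\phi_j+\theta)}$, $j\in\{1,\dots,N\}$, with $$R:=\beta\sqrt{\tau\Bigl(\rho-d+\frac1\tau\Bigr)}=\beta\sqrt{\tau\Bigl(\frac1\tau-\frac1{\tau^*}\Bigr)}<\beta,$$ is a solution of the system. (ii) If $d-\rho\le0$, then for every $\tau>0$ and every $\theta\in\mathbb{S}$ the rotational twisted state $z_j(t)=Re^{i(\omega t+\phi_j+\theta)}$, with $R:=\beta\sqrt{\tau(\rho-d+\frac1\tau)}\ge\beta$, is a solution of the system.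
   Context: $\mathbb{S}=\mathbb{R}/2\pi\mathbb{Z}$. A matrix $A\in M_N(\mathbb{R})$ is circulant, generated by $a=(a_0,\dots,a_{N-1})$, if $A_{jl}=a_{(l-j)\bmod N}$ for all $j,l\in\{1,\dots,N\}$, with remainder in $\{0,\dots,N-1\}$. The parameter $\tau$ is positive. *)

theory Defs
  imports Complex_Main
begin

(* An N x N real matrix is a function nat => nat => real of which only the entries with
   both indices in {1..N} matter; a generator (a_0,...,a_{N-1}) is a function nat => real
   of which only the values below N matter.  The remainder is taken in int because l - j
   may be negative. *)
definition circulant :: "nat \<Rightarrow> (nat \<Rightarrow> real) \<Rightarrow> (nat \<Rightarrow> nat \<Rightarrow> real) \<Rightarrow> bool" where
  "circulant N a A \<longleftrightarrow>
     (\<forall>j\<in>{1..N}. \<forall>l\<in>{1..N}. A j l = a (nat ((int l - int j) mod int N)))"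

definition stuart_landau_field ::
    "nat \<Rightarrow> (nat \<Rightarrow> nat \<Rightarrow> real) \<Rightarrow> real \<Rightarrow> real \<Rightarrow> (nat \<Rightarrow> complex) \<Rightarrow> nat \<Rightarrow> complex" where
  "stuart_landau_field N A \<beta> \<tau> z j =
     (\<Sum>l=1..N. of_real (A j l) * (z l - z j))
       + of_real (1 / \<tau> * (1 - (cmod (z j))\<^sup>2 / \<beta>\<^sup>2)) * z j"

(* z j t is the state of oscillator j at time t; solutions are global in time. *)
definition stuart_landau_solution ::
    "nat \<Rightarrow> (nat \<Rightarrow> nat \<Rightarrow> real) \<Rightarrow> real \<Rightarrow> real \<Rightarrow> (nat \<Rightarrow> real \<Rightarrow> complex) \<Rightarrow> bool" where
  "stuart_landau_solution N A \<beta> \<tau> z \<longleftrightarrow>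
     (\<forall>j\<in>{1..N}. \<forall>t. (z j has_vector_derivative
        stuart_landau_field N A \<beta> \<tau> (\<lambda>l. z l t) j) (at t))"

end

theory Submission imports Defs begin

text \<open>
  The vector with entries \<open>cis (\<phi> j)\<close> is a discrete Fourier mode, so it is a common eigenvector of all
  circulant matrices. For the diffusive coupling \<open>\<Sum>l. A j l * (z l - z j)\<close> the eigenvalue is
  \<open>(\<rho> - d) + \<i> \<omega>\<close>: subtracting \<open>z j\<close> removes the generator entry \<open>a 0\<close> and shifts the Fourier transform
  of the other entries, \<open>\<rho> + \<i> \<omega>\<close>, by their sum \<open>d\<close> (\<open>circulant_coupling_eigenvector\<close>).

  On a twisted state all moduli equal \<open>R\<close>, so the nonlinearity also acts as a scalar, namely
  \<open>(1 - R\<^sup>2 / \<beta>\<^sup>2) / \<tau>\<close>. The vector field is therefore a complex multiple of the state, and the state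
  rotates rigidly with frequency \<open>\<omega>\<close> as soon as the real part \<open>\<rho> - d + (1 - R\<^sup>2 / \<beta>\<^sup>2) / \<tau>\<close> vanishes
  (\<open>twisted_state_solution\<close>). This amplitude equation reads \<open>R\<^sup>2 / \<beta>\<^sup>2 = \<tau> * (\<rho> - d + 1 / \<tau>) =
  1 - \<tau> * (d - \<rho>)\<close>. The sign of \<open>d - \<rho>\<close> decides whether the right-hand side is below \<open>1\<close>;
  when \<open>d - \<rho> > 0\<close> it is nonnegative up to \<open>\<tau> = 1 / (d - \<rho>)\<close>.
\<close>

lemma bij_betw_cyclic_offset:
  fixes N j :: nat
  assumes "N \<ge> 1"
  shows "bij_betw (\<lambda>l. nat ((int l - int j) mod int N)) {1..N} {..<N}"
proof -
  let ?k = "\<lambda>l. nat ((int l - int j) mod int N)"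
  have inj: "inj_on ?k {1..N}"
  proof (rule inj_onI)
    fix l m assume l: "l \<in> {1..N}" and m: "m \<in> {1..N}" and eq: "?k l = ?k m"
    have "(int l - int j) mod int N = (int m - int j) mod int N"
      using eq assms by (simp add: eq_nat_nat_iff)
    then have "int N dvd (int l - int j) - (int m - int j)"
      by (rule mod_eq_dvd_iff[THEN iffD1])
    then have "int N dvd int l - int m" by simp
    moreover have "\<bar>int l - int m\<bar> < int N" using l m by auto
    ultimately have "int l - int m = 0" by (metis abs_of_nat dvd_imp_le_int linorder_not_less)
    then show "l = m" by simp
  qed
  have "?k ` {1..N} \<subseteq> {..<N}" using assms by (auto simp: nat_less_iff)
  then have "?k ` {1..N} = {..<N}"
    by (rule card_subset_eq[OF finite_lessThan]) (use card_image[OF inj] in simp)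
  with inj show ?thesis by (simp add: bij_betw_def)
qed

text \<open>Periodicity of \<open>cis\<close> absorbs the multiple of \<open>N\<close> that the remainder discards. This is what makes
  the mode compatible with the cyclic index shift.\<close>

lemma cis_cyclic_offset:
  fixes N j l :: nat
  assumes "N \<ge> 1"
  shows "cis (2 * pi * real l / real N) =
         cis (2 * pi * real j / real N)
           * cis (2 * pi * real (nat ((int l - int j) mod int N)) / real N)"
proof -
  define k where "k = nat ((int l - int j) mod int N)"
  define q where "q = (int l - int j) div int N"
  have "int k = (int l - int j) mod int N" using assms by (simp add: k_def)
  then have "int l = int j + int k + q * int N" by (simp add: q_def)
  then have "real_of_int (int l) = real_of_int (int j + int k + q * int N)" by (rule arg_cong)
  then have l: "real l = real j + real k + real_of_int q * real N" by simp
  have "2 * pi * real l / real N =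
        2 * pi * real j / real N + 2 * pi * real k / real N + 2 * pi * real_of_int q"
    using assms unfolding l by (simp add: field_simps)
  moreover have "cis (2 * pi * real_of_int q) = 1" by (rule cis_multiple_2pi) simp
  ultimately show ?thesis unfolding k_def by (simp flip: cis_mult)
qed

lemma circulant_coupling_eigenvector:
  fixes N j :: nat and a :: "nat \<Rightarrow> real" and \<phi> :: "nat \<Rightarrow> real"
  assumes N: "N \<ge> 1" and A: "circulant N a A" and j: "j \<in> {1..N}"
    and \<phi>: "\<And>l. \<phi> l = 2 * pi * real l / real N"
  shows "(\<Sum>l=1..N. of_real (A j l) * (cis (\<phi> l) - cis (\<phi> j))) =
         Complex ((\<Sum>l=1..N-1. a l * cos (\<phi> l)) - (\<Sum>l=1..N-1. a l))
                 (\<Sum>l=1..N-1. a l * sin (\<phi> l)) * cis (\<phi> j)"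
proof -
  let ?k = "\<lambda>l. nat ((int l - int j) mod int N)"
  let ?f = "\<lambda>k. of_real (a k) * (cis (\<phi> k) - 1)"
  have "(\<Sum>l=1..N. of_real (A j l) * (cis (\<phi> l) - cis (\<phi> j))) = (\<Sum>l=1..N. cis (\<phi> j) * ?f (?k l))"
  proof (rule sum.cong[OF refl])
    fix l assume l: "l \<in> {1..N}"
    have "A j l = a (?k l)" using A j l unfolding circulant_def by blast
    moreover have "cis (\<phi> l) = cis (\<phi> j) * cis (\<phi> (?k l))"
      unfolding \<phi> by (rule cis_cyclic_offset[OF N])
    ultimately show "of_real (A j l) * (cis (\<phi> l) - cis (\<phi> j)) = cis (\<phi> j) * ?f (?k l)"
      by (simp add: algebra_simps)
  qed
  also have "\<dots> = cis (\<phi> j) * (\<Sum>k<N. ?f k)"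
    unfolding sum_distrib_left[symmetric]
    by (subst sum.reindex_bij_betw[OF bij_betw_cyclic_offset[OF N], of ?f j]) simp
  \<comment> \<open>An oscillator does not couple to itself: the factor \<open>cis (\<phi> 0) - 1\<close> is zero.\<close>
  also have "(\<Sum>k<N. ?f k) = (\<Sum>k=1..N-1. ?f k)"
    by (rule sum.mono_neutral_right) (use \<phi>[of 0] in \<open>auto simp: not_le\<close>)
  also have "\<dots> = Complex ((\<Sum>l=1..N-1. a l * cos (\<phi> l)) - (\<Sum>l=1..N-1. a l))
                          (\<Sum>l=1..N-1. a l * sin (\<phi> l))"
    by (simp add: complex_eq_iff algebra_simps sum_subtractf)
  finally show ?thesis by (simp add: mult.commute)
qed

text \<open>The hypothesis \<open>amplitude\<close> is the real part of the nonlinear eigenvalue equation; the imaginary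
  part fixes the frequency as \<open>\<omega>\<close>. It is kept apart from the explicit value of \<open>R\<close>, which is one
  of its solutions and enters through \<open>twisted_amplitude_equation\<close>.\<close>

lemma twisted_state_solution:
  fixes N :: nat and a :: "nat \<Rightarrow> real" and \<phi> :: "nat \<Rightarrow> real" and \<beta> \<tau> d \<rho> \<omega> \<theta> R :: real
  assumes N: "N \<ge> 1" and A: "circulant N a A"
    and \<phi>: "\<And>l. \<phi> l = 2 * pi * real l / real N"
    and d: "d = (\<Sum>l=1..N-1. a l)"
    and \<rho>: "\<rho> = (\<Sum>l=1..N-1. a l * cos (\<phi> l))"
    and \<omega>: "\<omega> = (\<Sum>l=1..N-1. a l * sin (\<phi> l))"
    and amplitude: "\<rho> - d + 1 / \<tau> * (1 - R\<^sup>2 / \<beta>\<^sup>2) = 0"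
  shows "stuart_landau_solution N A \<beta> \<tau>
           (\<lambda>j t. of_real R * exp (\<i> * of_real (\<omega> * t + \<phi> j + \<theta>)))"
  unfolding stuart_landau_solution_def
proof (intro ballI allI)
  fix j t assume j: "j \<in> {1..N}"
  define z where "z = (\<lambda>l s. of_real R * exp (\<i> * of_real (\<omega> * s + \<phi> l + \<theta>)))"
  define c where "c = of_real R * cis (\<omega> * t + \<theta>)"
  have z: "z l t = c * cis (\<phi> l)" for l
    unfolding z_def c_def cis_conv_exp[symmetric] by (simp add: cis_mult algebra_simps)
  have "(\<Sum>l=1..N. of_real (A j l) * (z l t - z j t)) =
        c * (\<Sum>l=1..N. of_real (A j l) * (cis (\<phi> l) - cis (\<phi> j)))"
    unfolding z sum_distrib_left by (rule sum.cong) (simp_all add: algebra_simps)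
  also have "\<dots> = Complex (\<rho> - d) \<omega> * z j t"
    unfolding circulant_coupling_eigenvector[OF N A j \<phi>] d[symmetric] \<rho>[symmetric] \<omega>[symmetric] z
    by simp
  finally have coupling: "(\<Sum>l=1..N. of_real (A j l) * (z l t - z j t)) = Complex (\<rho> - d) \<omega> * z j t" .
  have modulus: "(cmod (z j t))\<^sup>2 = R\<^sup>2"
    unfolding z c_def by (simp add: norm_mult)
  have "stuart_landau_field N A \<beta> \<tau> (\<lambda>l. z l t) j =
        (Complex (\<rho> - d) \<omega> + of_real (1 / \<tau> * (1 - R\<^sup>2 / \<beta>\<^sup>2))) * z j t"
    unfolding stuart_landau_field_def coupling modulus by (simp add: algebra_simps)
  also have "Complex (\<rho> - d) \<omega> + of_real (1 / \<tau> * (1 - R\<^sup>2 / \<beta>\<^sup>2)) = \<i> * of_real \<omega>"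
    using amplitude by (simp add: complex_eq_iff)
  finally have field: "stuart_landau_field N A \<beta> \<tau> (\<lambda>l. z l t) j = \<i> * of_real \<omega> * z j t" .
  have "(z j has_vector_derivative \<i> * of_real \<omega> * z j t) (at t)"
  proof -
    have "((\<lambda>w. of_real R * exp (\<i> * (of_real \<omega> * w + of_real (\<phi> j) + of_real \<theta>)))
            has_field_derivative \<i> * of_real \<omega> * z j t) (at (of_real t))"
      unfolding z_def by (auto intro!: derivative_eq_intros)
    from has_vector_derivative_real_field[OF this] show ?thesis
      unfolding z_def by (simp add: o_def)
  qed
  then show "((\<lambda>s. of_real R * exp (\<i> * of_real (\<omega> * s + \<phi> j + \<theta>))) has_vector_derivative
      stuart_landau_field N A \<beta> \<tau> (\<lambda>l. of_real R * exp (\<i> * of_real (\<omega> * t + \<phi> l + \<theta>))) j) (at t)"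
    using field unfolding z_def by simp
qed

lemma twisted_amplitude_equation:
  fixes \<beta> \<tau> c :: real
  assumes "\<beta> > 0" "\<tau> > 0" "0 \<le> \<tau> * (c + 1 / \<tau>)"
  shows "c + 1 / \<tau> * (1 - (\<beta> * sqrt (\<tau> * (c + 1 / \<tau>)))\<^sup>2 / \<beta>\<^sup>2) = 0"
proof -
  have "(\<beta> * sqrt (\<tau> * (c + 1 / \<tau>)))\<^sup>2 / \<beta>\<^sup>2 = \<tau> * (c + 1 / \<tau>)"
    using assms by (simp add: power_mult_distrib)
  then show ?thesis using assms by (simp add: field_simps)
qed

theorem proposition4p2:
  fixes N :: nat and a :: "nat \<Rightarrow> real" and A :: "nat \<Rightarrow> nat \<Rightarrow> real"
    and \<phi> :: "nat \<Rightarrow> real" and \<beta> d \<rho> \<omega> :: real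
  assumes "N \<ge> 1"
    and "\<beta> > 0"
    and "circulant N a A"
    and "\<And>l. \<phi> l = 2 * pi * real l / real N"
    and "d = (\<Sum>l=1..N-1. a l)"
    and "\<rho> = (\<Sum>l=1..N-1. a l * cos (\<phi> l))"
    and "\<omega> = (\<Sum>l=1..N-1. a l * sin (\<phi> l))"
  shows "(d - \<rho> > 0 \<longrightarrow>
            (let \<tau>s = inverse (d - \<rho>) in
              \<forall>\<tau> \<theta>. 0 < \<tau> \<and> \<tau> < \<tau>s \<longrightarrow>
                (let R = \<beta> * sqrt (\<tau> * (\<rho> - d + 1 / \<tau>)) in
                  0 \<le> \<tau> * (\<rho> - d + 1 / \<tau>)
                  \<and> R = \<beta> * sqrt (\<tau> * (1 / \<tau> - 1 / \<tau>s))
                  \<and> R < \<beta>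
                  \<and> stuart_landau_solution N A \<beta> \<tau>
                       (\<lambda>j t. of_real R * exp (\<i> * of_real (\<omega> * t + \<phi> j + \<theta>))))))
       \<and> (d - \<rho> \<le> 0 \<longrightarrow>
            (\<forall>\<tau> \<theta>. \<tau> > 0 \<longrightarrow>
              (let R = \<beta> * sqrt (\<tau> * (\<rho> - d + 1 / \<tau>)) in
                0 \<le> \<tau> * (\<rho> - d + 1 / \<tau>)
                \<and> R \<ge> \<beta>
                \<and> stuart_landau_solution N A \<beta> \<tau>
                     (\<lambda>j t. of_real R * exp (\<i> * of_real (\<omega> * t + \<phi> j + \<theta>))))))"
proof -
  have solution: "stuart_landau_solution N A \<beta> \<tau>
      (\<lambda>j t. of_real (\<beta> * sqrt (\<tau> * (\<rho> - d + 1 / \<tau>))) * exp (\<i> * of_real (\<omega> * t + \<phi> j + \<theta>)))"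
    if "\<tau> > 0" "0 \<le> \<tau> * (\<rho> - d + 1 / \<tau>)" for \<tau> \<theta>
    by (rule twisted_state_solution[OF assms(1,3,4,5,6,7)
          twisted_amplitude_equation[OF assms(2) that]])
  have radicand: "\<tau> * (\<rho> - d + 1 / \<tau>) = 1 - \<tau> * (d - \<rho>)" if "\<tau> > 0" for \<tau>
    using that by (simp add: field_simps)
  show ?thesis
    unfolding Let_def
  proof (intro conjI impI allI; (elim conjE)?)
    fix \<tau> assume pos: "d - \<rho> > 0" and \<tau>: "0 < \<tau>" "\<tau> < inverse (d - \<rho>)"
    have small: "\<tau> * (d - \<rho>) < 1" using \<tau> pos by (simp add: field_simps)
    then show nonneg: "0 \<le> \<tau> * (\<rho> - d + 1 / \<tau>)" using radicand[OF \<tau>(1)] by linarith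
    show "\<beta> * sqrt (\<tau> * (\<rho> - d + 1 / \<tau>)) = \<beta> * sqrt (\<tau> * (1 / \<tau> - 1 / inverse (d - \<rho>)))"
      by (simp add: inverse_eq_divide algebra_simps)
    have "\<tau> * (\<rho> - d + 1 / \<tau>) < 1"
      using radicand[OF \<tau>(1)] mult_pos_pos[OF \<tau>(1) pos] by linarith
    then show "\<beta> * sqrt (\<tau> * (\<rho> - d + 1 / \<tau>)) < \<beta>"
      using assms(2) by simp
    show "stuart_landau_solution N A \<beta> \<tau> (\<lambda>j t. of_real (\<beta> * sqrt (\<tau> * (\<rho> - d + 1 / \<tau>)))
            * exp (\<i> * of_real (\<omega> * t + \<phi> j + \<theta>)))" for \<theta>
      by (rule solution[OF \<tau>(1) nonneg])
  next
    fix \<tau> :: real assume nonpos: "d - \<rho> \<le> 0" and \<tau>: "0 < \<tau>"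
    have ge1: "1 \<le> \<tau> * (\<rho> - d + 1 / \<tau>)"
      using radicand[OF \<tau>] mult_nonneg_nonpos[OF less_imp_le[OF \<tau>] nonpos] by linarith
    then show nonneg: "0 \<le> \<tau> * (\<rho> - d + 1 / \<tau>)" by linarith
    show "\<beta> \<le> \<beta> * sqrt (\<tau> * (\<rho> - d + 1 / \<tau>))"
      using ge1 assms(2) by simp
    show "stuart_landau_solution N A \<beta> \<tau> (\<lambda>j t. of_real (\<beta> * sqrt (\<tau> * (\<rho> - d + 1 / \<tau>)))
            * exp (\<i> * of_real (\<omega> * t + \<phi> j + \<theta>)))" for \<theta>
      by (rule solution[OF \<tau> nonneg])
  qed
qed

end
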